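(* Let $n \geq 2$ and let $q$ be a prime power. There exists an $(n,1)$-set of size $(q-1)^{n-1}$ in $\mathrm{PG}(n,q)$, i.e. a set of $(q-1)^{n-1}$ points of $\mathrm{PG}(n,q)$ no $n+1$ of which are collinear.
   Context: $\mathrm{PG}(n,q)$ is the projective space whose points and lines are the $1$- and $2$-dimensional subspaces of $\mathbb{F}_q^{n+1}$. An $(r,s)$-set is a set of points such that every $s$-dimensional projective subspace contains at most $r$ of its points; so an $(n,1)$-set is a point set meeting every line in at most $n$ points. *)

theory Defs
  imports "HOL-Analysis.Cartesian_Space" "HOL-Number_Theory.Prime_Powers"
begin

text \<open>
  With \<open>CARD('k) = q\<close> and \<open>CARD('m) = n + 1\<close>, the vector space \<open>'k ^ 'm\<close> is the
  underlying space of \<open>PG(n,q)\<close>. A projective subspace is represented by the corresponding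
  linear subspace, and a point lies on it iff it is contained in it as a subspace.
\<close>

definition pg_subspaces :: "nat \<Rightarrow> ('k::field ^ 'm) set set" where
  "pg_subspaces s = {U. vec.subspace U \<and> vec.dim U = s + 1}"

abbreviation pg_points :: "('k::field ^ 'm) set set" where
  "pg_points \<equiv> pg_subspaces 0"

abbreviation pg_lines :: "('k::field ^ 'm) set set" where
  "pg_lines \<equiv> pg_subspaces 1"

definition rs_set :: "nat \<Rightarrow> nat \<Rightarrow> ('k::{field,finite} ^ 'm) set set \<Rightarrow> bool" where
  "rs_set r s X \<longleftrightarrow>
     X \<subseteq> pg_points \<and> (\<forall>S \<in> pg_subspaces s. card {P \<in> X. P \<subseteq> S} \<le> r)"

definition pg_collinear :: "('k::field ^ 'm) set set \<Rightarrow> bool" where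
  "pg_collinear Y \<longleftrightarrow> (\<exists>L \<in> pg_lines. \<forall>P \<in> Y. P \<subseteq> L)"

end

theory Submission
  imports Defs "HOL-Computational_Algebra.Polynomial"
begin

text \<open>
  In affine coordinates take the points of the hypersurface \<open>x\<^sub>1 \<cdots> x\<^sub>n = 1\<close>. All but one coordinate
  can be chosen freely among the nonzero elements, so there are \<open>(q - 1)\<^bsup>n - 1\<^esup>\<close> of them. On a line
  \<open>u + t d\<close> the equation becomes \<open>\<Prod>\<^sub>i (u\<^sub>i + t d\<^sub>i) = 1\<close>, of degree at most \<open>n\<close> in \<open>t\<close>. It is not
  an identity: if \<open>d\<^sub>i \<noteq> 0\<close>, the left-hand side vanishes at \<open>t = - u\<^sub>i / d\<^sub>i\<close>. So a line contains at
  most \<open>n\<close> of the points.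
\<close>

lemma prod_affine_eq_const_bound:
  fixes u d :: "'i \<Rightarrow> 'k::field"
  assumes "finite I" "i \<in> I" "d i \<noteq> 0" "c \<noteq> 0"
  defines "T \<equiv> {t. (\<Prod>j\<in>I. u j + t * d j) = c}"
  shows "finite T \<and> card T \<le> card I"
proof -
  define p where "p = (\<Prod>j\<in>I. [:u j, d j:]) - [:c:]"
  have poly_p: "poly p t = (\<Prod>j\<in>I. u j + t * d j) - c" for t
    by (simp add: p_def poly_prod)
  then have T_eq: "T = {t. poly p t = 0}"
    by (simp add: T_def)
  have "\<exists>j\<in>I. u j + (- u i / d i) * d j = 0"
    using assms(2,3) by (intro bexI[of _ i]) simp_all
  then have "(\<Prod>j\<in>I. u j + (- u i / d i) * d j) = 0"
    using assms(1) by (rule prod_zero[rotated])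
  then have "poly p (- u i / d i) = - c"
    by (simp only: poly_p) simp
  with \<open>c \<noteq> 0\<close> have "p \<noteq> 0"
    by auto
  have "degree (\<Prod>j\<in>I. [:u j, d j:]) \<le> (\<Sum>j\<in>I. degree [:u j, d j:])"
    using degree_prod_sum_le[OF assms(1), of "\<lambda>j. [:u j, d j:]"] by (simp only: o_def)
  also have "\<dots> \<le> (\<Sum>j\<in>I. 1)"
    by (rule sum_mono) auto
  finally have "degree p \<le> card I"
    unfolding p_def by (intro degree_diff_le) auto
  with card_poly_roots_bound[OF \<open>p \<noteq> 0\<close>] poly_roots_finite[OF \<open>p \<noteq> 0\<close>] show ?thesis
    unfolding T_eq by simp
qed

lemma bij_betw_PiE_prod_eq_const:
  fixes c :: "'k::field"
  assumes "finite J" "e \<notin> J" "c \<noteq> 0"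
  shows "bij_betw (\<lambda>f. restrict f J) {f \<in> insert e J \<rightarrow>\<^sub>E UNIV. (\<Prod>i\<in>insert e J. f i) = c}
           (J \<rightarrow>\<^sub>E UNIV - {0})" (is "bij_betw _ ?A ?B")
proof (rule bij_betw_byWitness[where f' = "\<lambda>f. f(e := c / (\<Prod>i\<in>J. f i))"])
  have prod_insert: "(\<Prod>i\<in>insert e J. f i) = f e * (\<Prod>i\<in>J. f i)" for f :: "_ \<Rightarrow> 'k"
    using assms(1,2) by simp
  show "\<forall>f\<in>?A. (restrict f J)(e := c / (\<Prod>i\<in>J. restrict f J i)) = f"
  proof
    fix f assume f: "f \<in> ?A"
    then have "f e * (\<Prod>i\<in>J. f i) = c"
      by (simp add: prod_insert)
    with \<open>c \<noteq> 0\<close> have "c / (\<Prod>i\<in>J. f i) = f e"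
      by auto
    with f show "(restrict f J)(e := c / (\<Prod>i\<in>J. restrict f J i)) = f"
      by (auto simp: fun_eq_iff PiE_def extensional_def)
  qed
  show "\<forall>f\<in>?B. restrict (f(e := c / (\<Prod>i\<in>J. f i))) J = f"
    using assms(2) by (auto simp: fun_eq_iff restrict_def PiE_def extensional_def)
  show "(\<lambda>f. restrict f J) ` ?A \<subseteq> ?B"
    using \<open>c \<noteq> 0\<close> \<open>finite J\<close> by (auto simp: prod_insert)
  show "(\<lambda>f. f(e := c / (\<Prod>i\<in>J. f i))) ` ?B \<subseteq> ?A"
  proof (intro image_subsetI CollectI conjI)
    fix f assume f: "f \<in> ?B"
    then have "(\<Prod>i\<in>J. f i) \<noteq> 0"
      using \<open>finite J\<close> by (auto simp: PiE_def Pi_def)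
    moreover have "(\<Prod>i\<in>J. (f(e := a)) i) = (\<Prod>i\<in>J. f i)" for a
      using assms(2) by (intro prod.cong) auto
    ultimately show "(\<Prod>i\<in>insert e J. (f(e := c / (\<Prod>i\<in>J. f i))) i) = c"
      unfolding prod_insert by simp
    show "f(e := c / (\<Prod>i\<in>J. f i)) \<in> insert e J \<rightarrow>\<^sub>E UNIV"
      using f by (auto simp: PiE_def extensional_def)
  qed
qed

lemma card_PiE_prod_eq_const:
  fixes c :: "'k::{field,finite}"
  assumes "finite I" "I \<noteq> {}" "c \<noteq> 0"
  shows "card {f \<in> I \<rightarrow>\<^sub>E UNIV. (\<Prod>i\<in>I. f i) = c} = (CARD('k) - 1) ^ (card I - 1)"
proof -
  obtain e J where I: "I = insert e J" "e \<notin> J"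
    using assms(2) by (metis ex_in_conv mk_disjoint_insert)
  with assms(1) have "finite J"
    by simp
  have "card {f \<in> I \<rightarrow>\<^sub>E UNIV. (\<Prod>i\<in>I. f i) = c} = card (J \<rightarrow>\<^sub>E UNIV - {0 :: 'k})"
    unfolding I(1)
    using bij_betw_PiE_prod_eq_const[OF \<open>finite J\<close> I(2) assms(3)] by (rule bij_betw_same_card)
  also have "\<dots> = (CARD('k) - 1) ^ (card I - 1)"
    using \<open>finite J\<close> I by (simp add: card_PiE)
  finally show ?thesis .
qed

definition affine_chart :: "'m::finite \<Rightarrow> ('k::field ^ 'm) set" where
  "affine_chart h = {v. v $ h = 1}"

definition projectivize :: "('k::field ^ 'm::finite) set \<Rightarrow> ('k ^ 'm) set set" where
  "projectivize A = (\<lambda>v. vec.span {v}) ` A"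

lemma zero_notin_affine_chart: "0 \<notin> affine_chart h"
  by (simp add: affine_chart_def)

lemma affine_chart_mem_span_singleton_iff:
  assumes "v \<in> affine_chart h" "w \<in> affine_chart h"
  shows "v \<in> vec.span {w} \<longleftrightarrow> v = w"
proof
  assume "v \<in> vec.span {w}"
  then obtain a where "v = a *s w"
    by (auto simp: vec.span_singleton)
  with assms show "v = w"
    by (simp add: affine_chart_def)
qed (simp add: vec.span_base)

lemma card_projectivize:
  assumes "A \<subseteq> affine_chart h"
  shows "card (projectivize A) = card A"
  unfolding projectivize_def
proof (intro card_image inj_onI)
  fix v w assume "v \<in> A" "w \<in> A" "vec.span {v} = vec.span {w}"
  then show "v = w"
    using assms affine_chart_mem_span_singleton_iff[of v h w] vec.span_base[of v "{v}"] by auto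
qed

lemma projectivize_subset_pg_points:
  assumes "0 \<notin> A"
  shows "projectivize A \<subseteq> pg_points"
  using assms by (auto simp: projectivize_def pg_subspaces_def vec.dim_insert)

lemma projectivize_within_subspace:
  assumes "vec.subspace S"
  shows "{P \<in> projectivize A. P \<subseteq> S} = projectivize (A \<inter> S)"
  using assms by (auto simp: projectivize_def intro: vec.span_base dest: vec.span_minimal[rotated])

lemma rs_set_projectivize_iff:
  fixes A :: "('k::{field,finite} ^ 'm::finite) set"
  assumes "A \<subseteq> affine_chart h"
  shows "rs_set r s (projectivize A) \<longleftrightarrow> (\<forall>S \<in> pg_subspaces s. card (A \<inter> S) \<le> r)"
proof -
  have "projectivize A \<subseteq> pg_points"
    using assms zero_notin_affine_chart by (intro projectivize_subset_pg_points) blast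
  moreover have "card {P \<in> projectivize A. P \<subseteq> S} = card (A \<inter> S)" if "S \<in> pg_subspaces s" for S
    using that assms
    by (simp add: pg_subspaces_def projectivize_within_subspace card_projectivize[of _ h] le_infI1)
  ultimately show ?thesis
    by (simp add: rs_set_def)
qed

lemma rs_set_imp_not_pg_collinear:
  fixes X :: "('k::{field,finite} ^ 'm::finite) set set"
  assumes "rs_set r 1 X" "Y \<subseteq> X" "card Y > r"
  shows "\<not> pg_collinear Y"
proof
  assume "pg_collinear Y"
  then obtain L where L: "L \<in> pg_lines" "\<forall>P\<in>Y. P \<subseteq> L"
    by (auto simp: pg_collinear_def)
  then have "card Y \<le> card {P \<in> X. P \<subseteq> L}"
    using assms(2) by (intro card_mono) auto
  also have "\<dots> \<le> r"
    using assms(1) L(1) by (simp add: rs_set_def)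
  finally show False
    using assms(3) by simp
qed

lemma pg_line_Int_affine_chart:
  assumes L: "L \<in> pg_lines"
    and u: "u \<in> L \<inter> affine_chart h" and w: "w \<in> L \<inter> affine_chart h" and "u \<noteq> w"
  shows "L \<inter> affine_chart h = range (\<lambda>t. u + t *s (w - u))"
proof
  have sub: "vec.subspace L" and dim: "vec.dim L = 2"
    using L by (auto simp: pg_subspaces_def)
  have "vec.independent {u, w}"
    using u w \<open>u \<noteq> w\<close> zero_notin_affine_chart[of h]
    by (auto simp: vec.independent_insert vec.dependent_single affine_chart_mem_span_singleton_iff)
  then have span: "L \<subseteq> vec.span {u, w}"
    using u w dim \<open>u \<noteq> w\<close> by (intro vec.card_ge_dim_independent) auto
  show "L \<inter> affine_chart h \<subseteq> range (\<lambda>t. u + t *s (w - u))"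
  proof
    fix v assume v: "v \<in> L \<inter> affine_chart h"
    with span obtain a b where ab: "v = a *s u + b *s w"
      by (auto simp: vec.span_insert vec.span_singleton algebra_simps)
    then have "v $ h = a * u $ h + b * w $ h"
      by simp
    then have "a = 1 - b"
      using u v w by (simp add: affine_chart_def eq_diff_eq)
    with ab have "v = u + b *s (w - u)"
      by (simp add: vec_eq_iff algebra_simps)
    then show "v \<in> range (\<lambda>t. u + t *s (w - u))"
      by blast
  qed
  show "range (\<lambda>t. u + t *s (w - u)) \<subseteq> L \<inter> affine_chart h"
    using u w sub
    by (auto simp: affine_chart_def intro: vec.subspace_add vec.subspace_scale vec.subspace_diff)
qed

definition product_hypersurface :: "'m::finite \<Rightarrow> 'k::field \<Rightarrow> ('k ^ 'm) set" where
  "product_hypersurface h c = {v \<in> affine_chart h. (\<Prod>i\<in>- {h}. v $ i) = c}"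

lemma product_hypersurface_subset_affine_chart: "product_hypersurface h c \<subseteq> affine_chart h"
  by (auto simp: product_hypersurface_def)

lemma bij_betw_affine_chart_PiE:
  fixes h :: "'m::finite"
  shows "bij_betw (\<lambda>v. restrict (($) v) (- {h})) (affine_chart h)
           (- {h} \<rightarrow>\<^sub>E (UNIV :: 'k::field set))"
  by (rule bij_betw_byWitness[where f' = "\<lambda>f. \<chi> i. if i = h then 1 else f i"])
    (auto simp: affine_chart_def vec_eq_iff fun_eq_iff PiE_def extensional_def)

lemma card_product_hypersurface:
  fixes h :: "'m::finite" and c :: "'k::{field,finite}"
  assumes "CARD('m) \<ge> 2" "c \<noteq> 0"
  shows "card (product_hypersurface h c) = (CARD('k) - 1) ^ (CARD('m) - 2)"
proof -
  have card_coords: "card (- {h}) = CARD('m) - 1"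
    by (simp add: Compl_eq_Diff_UNIV card_Diff_subset)
  with assms(1) have "- {h} \<noteq> {}"
    by fastforce
  have "bij_betw (\<lambda>v. restrict (($) v) (- {h})) (product_hypersurface h c)
          {f \<in> - {h} \<rightarrow>\<^sub>E UNIV. (\<Prod>i\<in>- {h}. f i) = c}"
    unfolding product_hypersurface_def
    by (rule bij_betw_Collect[OF bij_betw_affine_chart_PiE]) simp
  then have "card (product_hypersurface h c) =
      card {f \<in> - {h} \<rightarrow>\<^sub>E UNIV. (\<Prod>i\<in>- {h}. f i) = c}"
    by (rule bij_betw_same_card)
  also have "\<dots> = (CARD('k) - 1) ^ (CARD('m) - 2)"
    using card_PiE_prod_eq_const[OF _ \<open>- {h} \<noteq> {}\<close> assms(2)]
    by (simp add: card_coords numeral_2_eq_2)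
  finally show ?thesis .
qed

lemma product_hypersurface_Int_affine_line_bound:
  fixes u d :: "'k::field ^ 'm::finite"
  assumes "d \<noteq> 0" "d $ h = 0" "c \<noteq> 0"
  defines "A \<equiv> product_hypersurface h c \<inter> range (\<lambda>t. u + t *s d)"
  shows "finite A \<and> card A \<le> CARD('m) - 1"
proof -
  define T where "T = {t. (\<Prod>j\<in>- {h}. u $ j + t * d $ j) = c}"
  obtain i where "d $ i \<noteq> 0"
    using \<open>d \<noteq> 0\<close> by (auto simp: vec_eq_iff)
  with \<open>d $ h = 0\<close> have "i \<in> - {h}"
    by auto
  then have T: "finite T \<and> card T \<le> CARD('m) - 1"
    using prod_affine_eq_const_bound[of "- {h}" i "($) d" c "($) u"] \<open>d $ i \<noteq> 0\<close> \<open>c \<noteq> 0\<close>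
    by (simp add: T_def Compl_eq_Diff_UNIV card_Diff_subset)
  have "A \<subseteq> (\<lambda>t. u + t *s d) ` T"
    by (auto simp: A_def product_hypersurface_def T_def)
  with T show ?thesis
    by (meson finite_surj le_trans surj_card_le)
qed

lemma product_hypersurface_Int_pg_line_bound:
  fixes L :: "('k::field ^ 'm::finite) set" and h :: 'm
  assumes "L \<in> pg_lines" "c \<noteq> 0" "CARD('m) \<ge> 2"
  defines "A \<equiv> product_hypersurface h c \<inter> L"
  shows "finite A \<and> card A \<le> CARD('m) - 1"
proof -
  consider "A = {}" | u where "A = {u}" | u w where "u \<in> A" "w \<in> A" "u \<noteq> w"
    by blast
  then show ?thesis
  proof cases
    case (3 u w)
    then have chart: "u \<in> L \<inter> affine_chart h" "w \<in> L \<inter> affine_chart h"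
      by (auto simp: A_def product_hypersurface_def)
    have "A = product_hypersurface h c \<inter> (L \<inter> affine_chart h)"
      by (auto simp: A_def product_hypersurface_def)
    also have "\<dots> = product_hypersurface h c \<inter> range (\<lambda>t. u + t *s (w - u))"
      using pg_line_Int_affine_chart[OF assms(1) chart \<open>u \<noteq> w\<close>] by simp
    finally show ?thesis
      using product_hypersurface_Int_affine_line_bound[of "w - u" h c u] chart \<open>u \<noteq> w\<close> \<open>c \<noteq> 0\<close>
      by (simp add: affine_chart_def)
  qed (use assms(3) in simp_all)
qed

theorem theorem2:
  fixes n q :: nat
  assumes "n \<ge> 2"
    and "primepow q"
    and "CARD('k::{field,finite}) = q"
    and "CARD('m::finite) = n + 1"
  shows "\<exists>X :: ('k ^ 'm) set set.
           rs_set n 1 X \<and>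
           card X = (q - 1) ^ (n - 1) \<and>
           (\<forall>Y \<subseteq> X. card Y = n + 1 \<longrightarrow> \<not> pg_collinear Y)"
proof -
  fix h :: 'm
  define H :: "('k ^ 'm) set" where "H = product_hypersurface h 1"
  have chart: "H \<subseteq> affine_chart h"
    unfolding H_def by (rule product_hypersurface_subset_affine_chart)
  have "card (H \<inter> L) \<le> n" if "L \<in> pg_lines" for L
    using product_hypersurface_Int_pg_line_bound[OF that, of 1 h] assms by (simp add: H_def)
  then have "rs_set n 1 (projectivize H)"
    by (simp add: rs_set_projectivize_iff[OF chart])
  moreover have "card H = (q - 1) ^ (n - 1)"
    using card_product_hypersurface[of "1 :: 'k" h] assms by (simp add: H_def numeral_2_eq_2)
  then have "card (projectivize H) = (q - 1) ^ (n - 1)"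
    by (simp only: card_projectivize[OF chart])
  ultimately show ?thesis
    using rs_set_imp_not_pg_collinear[of n "projectivize H"] by auto
qed

end
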